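(* Let $R$ be a ring. If the polynomial ring $R[x]$ is a $C\Delta$ ring, then $R$ satisfies the Köthe conjecture.
   Context: All rings are associative with identity, not necessarily commutative. For a ring $S$, $U(S)$ is the group of units of $S$ and $C(S)$ its set of central elements; $\Delta(S)=\{a\in S : 1-ua\in U(S)\text{ for all }u\in U(S)\}$. A ring $S$ is called $C\Delta$ if every $a\in S$ can be written as $a=c+r$ with $c\in C(S)$ and $r\in\Delta(S)$. $Nil^*(R)$ denotes the upper nil-radical of $R$, i.e. the sum of all nil (two-sided) ideals of $R$, which is the largest nil ideal of $R$. "$R$ satisfies the Köthe conjecture" means that every nil left ideal and every nil right ideal of $R$ is contained in $Nil^*(R)$. In $R[x]$ the variable $x$ commutes with the elements of $R$. *)

theory Defs
  imports "HOL-Algebra.UnivPoly"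
begin

definition ring_centre :: "('a, 'b) ring_scheme \<Rightarrow> 'a set" where
  "ring_centre S = {c \<in> carrier S. \<forall>x \<in> carrier S. c \<otimes>\<^bsub>S\<^esub> x = x \<otimes>\<^bsub>S\<^esub> c}"

definition Delta :: "('a, 'b) ring_scheme \<Rightarrow> 'a set" where
  "Delta S = {a \<in> carrier S. \<forall>u \<in> Units S. \<one>\<^bsub>S\<^esub> \<ominus>\<^bsub>S\<^esub> (u \<otimes>\<^bsub>S\<^esub> a) \<in> Units S}"

definition CDelta_ring :: "('a, 'b) ring_scheme \<Rightarrow> bool" where
  "CDelta_ring S \<longleftrightarrow>
     ring S \<and> (\<forall>a \<in> carrier S. \<exists>c \<in> ring_centre S. \<exists>r \<in> Delta S. a = c \<oplus>\<^bsub>S\<^esub> r)"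

locale left_ideal = additive_subgroup I R + ring R for I and R (structure) +
  assumes l_closed: "\<lbrakk>a \<in> I; x \<in> carrier R\<rbrakk> \<Longrightarrow> x \<otimes> a \<in> I"

locale right_ideal = additive_subgroup I R + ring R for I and R (structure) +
  assumes r_closed: "\<lbrakk>a \<in> I; x \<in> carrier R\<rbrakk> \<Longrightarrow> a \<otimes> x \<in> I"

definition nil_subset :: "('a, 'b) ring_scheme \<Rightarrow> 'a set \<Rightarrow> bool" where
  "nil_subset R I \<longleftrightarrow> (\<forall>a \<in> I. \<exists>n::nat. n > 0 \<and> a [^]\<^bsub>R\<^esub> n = \<zero>\<^bsub>R\<^esub>)"

text \<open>The sum of the family of all nil two-sided ideals: its elements are the finite sums
  in which each summand \<open>f I\<close> is taken from the nil ideal \<open>I\<close>.\<close>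

definition upper_nilradical :: "('a, 'b) ring_scheme \<Rightarrow> 'a set" where
  "upper_nilradical R =
     {finsum R f F | f F. finite F \<and> (\<forall>I \<in> F. ideal I R \<and> nil_subset R I \<and> f I \<in> I)}"

definition satisfies_Koethe :: "('a, 'b) ring_scheme \<Rightarrow> bool" where
  "satisfies_Koethe R \<longleftrightarrow>
     (\<forall>I. left_ideal I R \<and> nil_subset R I \<longrightarrow> I \<subseteq> upper_nilradical R) \<and>
     (\<forall>I. right_ideal I R \<and> nil_subset R I \<longrightarrow> I \<subseteq> upper_nilradical R)"

end

theory Submission
  imports Defs "HOL-Algebra.Multiplicative_Group"
begin

text \<open>
  The nilpotent elements of \<open>R\<close> form an ideal, which then contains every nil one-sided ideal.
  Write \<open>a x = c + r\<close> with \<open>c\<close> central and \<open>r \<in> \<Delta>(R[x])\<close>. The coefficients of \<open>r\<close> in degrees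
  \<open>\<ge> 2\<close> are central, and since \<open>1 - r\<close> is a unit, the leading one is nilpotent as long as the
  degree is at least 2. Central nilpotents lie in \<open>\<Delta>(R[x])\<close>, so these terms can be stripped off one
  by one, which leaves an element \<open>b x + d\<close> of \<open>\<Delta>(R[x])\<close> with \<open>d\<close> central and \<open>a - b\<close> central.
  For such a \<open>b\<close> and a unit \<open>t\<close> of \<open>R\<close>, the element \<open>v = t\<^sup>-\<^sup>1 + d\<close> is a unit and
  \<open>t v (1 - v\<^sup>-\<^sup>1 (b x + d)) = 1 - t b x\<close>, so \<open>t b\<close> is nilpotent. Conversely every nilpotent
  element is such a \<open>b\<close>. As \<open>\<Delta>(R[x])\<close> is closed under addition, so is the set of nilpotents, and
  \<open>m n = (1 + m) n - n\<close> shows that it is closed under multiplication; it absorbs \<open>R\<close> because every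
  element of \<open>R\<close> is the sum of a central and a nilpotent one.
\<close>

text \<open>The exponent 0 is allowed and adds nothing: \<open>a [^] 0 = \<zero>\<close> forces the
  zero ring.\<close>

definition nilpotents :: "('a, 'b) ring_scheme \<Rightarrow> 'a set" where
  "nilpotents S = {a \<in> carrier S. \<exists>n::nat. a [^]\<^bsub>S\<^esub> n = \<zero>\<^bsub>S\<^esub>}"

lemma nilpotents_closed: "a \<in> nilpotents S \<Longrightarrow> a \<in> carrier S"
  by (simp add: nilpotents_def)

lemma ring_centre_closed: "c \<in> ring_centre S \<Longrightarrow> c \<in> carrier S"
  by (simp add: ring_centre_def)

lemma ring_centre_commute:
  "\<lbrakk>c \<in> ring_centre S; x \<in> carrier S\<rbrakk> \<Longrightarrow> c \<otimes>\<^bsub>S\<^esub> x = x \<otimes>\<^bsub>S\<^esub> c"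
  by (simp add: ring_centre_def)

lemma Delta_closed: "a \<in> Delta S \<Longrightarrow> a \<in> carrier S"
  by (simp add: Delta_def)

lemma DeltaD:
  "\<lbrakk>a \<in> Delta S; u \<in> Units S\<rbrakk> \<Longrightarrow> \<one>\<^bsub>S\<^esub> \<ominus>\<^bsub>S\<^esub> (u \<otimes>\<^bsub>S\<^esub> a) \<in> Units S"
  by (simp add: Delta_def)

lemma nil_subset_nilpotents: "nil_subset R I \<Longrightarrow> I \<subseteq> carrier R \<Longrightarrow> I \<subseteq> nilpotents R"
  by (auto simp: nil_subset_def nilpotents_def)

section \<open>Nilpotents, the centre and \<open>Delta\<close> in an arbitrary ring\<close>

context ring
begin

lemma ring_centre_zero: "\<zero> \<in> ring_centre R"
  by (simp add: ring_centre_def)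

lemma ring_centre_add: "\<lbrakk>c \<in> ring_centre R; d \<in> ring_centre R\<rbrakk> \<Longrightarrow> c \<oplus> d \<in> ring_centre R"
  by (simp add: ring_centre_def l_distr r_distr)

lemma ring_centre_a_inv: "c \<in> ring_centre R \<Longrightarrow> \<ominus> c \<in> ring_centre R"
  by (simp add: ring_centre_def l_minus r_minus)

lemma nilpotents_a_inv:
  assumes "a \<in> nilpotents R"
  shows "\<ominus> a \<in> nilpotents R"
proof -
  obtain n :: nat where a: "a \<in> carrier R" and n: "a [^] n = \<zero>"
    using assms by (auto simp: nilpotents_def)
  have "(\<ominus> a) [^] k = a [^] k \<or> (\<ominus> a) [^] k = \<ominus> (a [^] k)" for k :: nat
    by (induction k) (auto simp: a l_minus r_minus)
  then show ?thesis
    using a n by (metis (mono_tags, lifting) a_inv_closed mem_Collect_eq minus_zero nilpotents_def)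
qed

lemma nilpotents_mult_commuting:
  assumes "a \<in> nilpotents R" "b \<in> carrier R" "a \<otimes> b = b \<otimes> a"
  shows "a \<otimes> b \<in> nilpotents R"
proof -
  obtain n :: nat where a: "a \<in> carrier R" and n: "a [^] n = \<zero>"
    using assms by (auto simp: nilpotents_def)
  have "(a \<otimes> b) [^] n = \<zero>"
    using pow_mult_distrib[OF assms(3) a assms(2), of n] n assms(2) by simp
  then show ?thesis using a assms(2) by (auto simp: nilpotents_def)
qed

lemma nilpotents_add_commuting:
  assumes "a \<in> nilpotents R" "b \<in> nilpotents R" "a \<otimes> b = b \<otimes> a"
  shows "a \<oplus> b \<in> nilpotents R"
proof -
  obtain m n :: nat where a: "a \<in> carrier R" "a [^] m = \<zero>" and b: "b \<in> carrier R" "b [^] n = \<zero>"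
    using assms by (auto simp: nilpotents_def)
  have a_zero: "a [^] i = \<zero>" if "m \<le> i" for i
    using nat_pow_mult[of a m "i - m"] that a by simp
  have b_zero: "b [^] j = \<zero>" if "n \<le> j" for j
    using nat_pow_mult[of b n "j - n"] that b by simp
  \<comment> \<open>This avoids the binomial formula: one factor \<open>a \<oplus> b\<close> at a
    time is absorbed into the monomial on the right, raising \<open>i\<close> or \<open>j\<close> by
    one and keeping \<open>l + i + j\<close> constant.\<close>
  have "(a \<oplus> b) [^] l \<otimes> (a [^] i \<otimes> b [^] j) = \<zero>" if "m + n \<le> l + i + j" for l i j :: nat
    using that
  proof (induction l arbitrary: i j)
    case 0
    then have "m \<le> i \<or> n \<le> j" by linarith
    then show ?case using a b a_zero b_zero by auto
  next
    case (Suc l)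
    have ba: "b \<otimes> a [^] i = a [^] i \<otimes> b"
      using group_commutes_pow[OF assms(3) a(1) b(1)] by simp
    have "b \<otimes> (a [^] i \<otimes> b [^] j) = a [^] i \<otimes> b [^] Suc j"
      using a b ba nat_pow_Suc2[of b j] by (metis m_assoc nat_pow_closed)
    moreover have "a \<otimes> (a [^] i \<otimes> b [^] j) = a [^] Suc i \<otimes> b [^] j"
      using a b nat_pow_Suc2[of a i] by (metis m_assoc nat_pow_closed)
    ultimately have "(a \<oplus> b) [^] Suc l \<otimes> (a [^] i \<otimes> b [^] j) =
        (a \<oplus> b) [^] l \<otimes> (a [^] Suc i \<otimes> b [^] j) \<oplus> (a \<oplus> b) [^] l \<otimes> (a [^] i \<otimes> b [^] Suc j)"
      using a b by (simp add: m_assoc l_distr r_distr)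
    also have "\<dots> = \<zero>"
      using Suc.IH[of "Suc i" j] Suc.IH[of i "Suc j"] Suc.prems by simp
    finally show ?case .
  qed
  from this[of "m + n" 0 0] show ?thesis
    using a b by (auto simp: nilpotents_def)
qed

text \<open>The inverse is the geometric sum \<open>s\<close> of the powers of \<open>a\<close>
  below \<open>n\<close>; its products with \<open>\<one> \<ominus> a\<close> telescope on both
  sides.\<close>

lemma one_minus_nilpotent_Units:
  assumes "a \<in> nilpotents R"
  shows "\<one> \<ominus> a \<in> Units R"
proof -
  obtain n :: nat where a: "a \<in> carrier R" and n: "a [^] n = \<zero>"
    using assms by (auto simp: nilpotents_def)
  have "\<exists>s \<in> carrier R. s \<otimes> (\<one> \<ominus> a) = \<one> \<ominus> a [^] k \<and> (\<one> \<ominus> a) \<otimes> s = \<one> \<ominus> a [^] k"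
    for k :: nat
  proof (induction k)
    case 0
    then show ?case using a by (intro bexI[of _ \<zero>]) (simp_all add: minus_eq r_neg)
  next
    case (Suc k)
    then obtain s where s: "s \<in> carrier R" "s \<otimes> (\<one> \<ominus> a) = \<one> \<ominus> a [^] k"
      "(\<one> \<ominus> a) \<otimes> s = \<one> \<ominus> a [^] k"
      by blast
    have *: "(\<one> \<ominus> y) \<oplus> (y \<ominus> z) = \<one> \<ominus> z" if "y \<in> carrier R" "z \<in> carrier R" for y z
      using that by (simp add: minus_eq a_assoc r_neg1)
    have "(s \<oplus> a [^] k) \<otimes> (\<one> \<ominus> a) = (\<one> \<ominus> a [^] k) \<oplus> (a [^] k \<ominus> a [^] Suc k)"
      using s a by (simp add: l_distr) (simp add: minus_eq r_distr r_minus)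
    moreover have "(\<one> \<ominus> a) \<otimes> (s \<oplus> a [^] k) = (\<one> \<ominus> a [^] k) \<oplus> (a [^] k \<ominus> a [^] Suc k)"
      unfolding nat_pow_Suc2[OF a]
      using s a by (simp add: r_distr) (simp add: minus_eq l_distr l_minus)
    ultimately show ?case
      using s a *[of "a [^] k" "a [^] Suc k"]
      by (intro bexI[of _ "s \<oplus> a [^] k"]) simp_all
  qed
  from this[of n] show ?thesis
    using a n by (auto simp: Units_def minus_eq)
qed

text \<open>With the unit \<open>v = \<one> \<ominus> u \<otimes> a\<close>, the element
  \<open>\<one> \<ominus> u \<otimes> (a \<oplus> b)\<close> factors as \<open>v \<otimes> (\<one>
  \<ominus> (inv v \<otimes> u) \<otimes> b)\<close>, and \<open>inv v \<otimes> u\<close> is again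
  a unit.\<close>

lemma Delta_add:
  assumes "a \<in> Delta R" "b \<in> Delta R"
  shows "a \<oplus> b \<in> Delta R"
proof -
  have ab: "a \<in> carrier R" "b \<in> carrier R"
    using assms by (simp_all add: Delta_closed)
  have "\<one> \<ominus> u \<otimes> (a \<oplus> b) \<in> Units R" if u: "u \<in> Units R" for u
  proof -
    define v where "v = \<one> \<ominus> u \<otimes> a"
    have v: "v \<in> Units R"
      using DeltaD[OF assms(1) u] by (simp add: v_def)
    have "v \<otimes> (\<one> \<ominus> (inv v \<otimes> u) \<otimes> b) = v \<ominus> (v \<otimes> inv v) \<otimes> (u \<otimes> b)"
      using u v ab by (simp add: minus_eq r_distr r_minus m_assoc Units_closed del: Units_r_inv)
    also have "\<dots> = \<one> \<ominus> u \<otimes> (a \<oplus> b)"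
      using u v ab by (simp add: v_def minus_eq r_distr a_assoc a_comm[of "\<ominus> (u \<otimes> a)"] minus_add Units_closed)
    finally show ?thesis
      using v DeltaD[OF assms(2), of "inv v \<otimes> u"] u by (metis Units_inv_Units Units_m_closed)
  qed
  then show ?thesis using ab by (simp add: Delta_def)
qed

lemma central_nilpotent_Delta:
  assumes "z \<in> ring_centre R" "z \<in> nilpotents R"
  shows "z \<in> Delta R"
proof -
  have "\<one> \<ominus> u \<otimes> z \<in> Units R" if "u \<in> Units R" for u
    using that assms one_minus_nilpotent_Units nilpotents_mult_commuting[of z u]
    by (metis Units_closed ring_centre_commute)
  then show ?thesis
    using assms by (simp add: Delta_def ring_centre_closed)
qed

lemma nil_ideal_subset_upper_nilradical:
  assumes "ideal I R" "nil_subset R I"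
  shows "I \<subseteq> upper_nilradical R"
proof
  fix a assume "a \<in> I"
  moreover from this have "finsum R (\<lambda>_. a) {I} = a"
    using ideal.Icarr[OF assms(1)] by simp
  ultimately show "a \<in> upper_nilradical R"
    using assms unfolding upper_nilradical_def
    by (intro CollectI exI[of _ "\<lambda>_. a"] exI[of _ "{I}"]) simp
qed

end

section \<open>Coefficients, centre and units of the polynomial ring\<close>

context UP_ring
begin

lemma coeff_minus:
  "\<lbrakk>p \<in> carrier P; q \<in> carrier P\<rbrakk> \<Longrightarrow> coeff P (p \<ominus>\<^bsub>P\<^esub> q) n = coeff P p n \<ominus> coeff P q n"
  by (simp add: P.minus_eq R.minus_eq)

text \<open>Rewriting with this lemma and its mirror image goes with deleting
  \<open>coeff_mult\<close>, which would unfold the product into a convolution.\<close>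

lemma coeff_monom_mult:
  assumes "a \<in> carrier R" "q \<in> carrier P"
  shows "coeff P (monom P a n \<otimes>\<^bsub>P\<^esub> q) k = (if n \<le> k then a \<otimes> coeff P q (k - n) else \<zero>)"
proof -
  have "coeff P (monom P a n \<otimes>\<^bsub>P\<^esub> q) k =
      (\<Oplus>i\<in>{..k}. if n = i then a \<otimes> coeff P q (k - i) else \<zero>)"
    using assms by (auto intro!: R.finsum_cong')
  also have "\<dots> = (if n \<le> k then a \<otimes> coeff P q (k - n) else \<zero>)"
  proof (cases "n \<le> k")
    case True
    then show ?thesis
      using assms R.finsum_singleton[of n "{..k}" "\<lambda>i. a \<otimes> coeff P q (k - i)"] by auto
  next
    case False
    then have "(\<Oplus>i\<in>{..k}. if n = i then a \<otimes> coeff P q (k - i) else \<zero>) = (\<Oplus>i\<in>{..k}. \<zero>)"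
      by (intro R.finsum_cong') auto
    then show ?thesis using False by simp
  qed
  finally show ?thesis .
qed

lemma coeff_mult_monom:
  assumes "a \<in> carrier R" "q \<in> carrier P"
  shows "coeff P (q \<otimes>\<^bsub>P\<^esub> monom P a n) k = (if n \<le> k then coeff P q (k - n) \<otimes> a else \<zero>)"
proof (cases "n \<le> k")
  case True
  have "coeff P (q \<otimes>\<^bsub>P\<^esub> monom P a n) k =
      (\<Oplus>i\<in>{..k}. if k - n = i then coeff P q i \<otimes> a else \<zero>)"
    using assms True by (auto intro!: R.finsum_cong')
  then show ?thesis
    using assms True R.finsum_singleton[of "k - n" "{..k}" "\<lambda>i. coeff P q i \<otimes> a"] by auto
next
  case False
  then have "coeff P (q \<otimes>\<^bsub>P\<^esub> monom P a n) k = (\<Oplus>i\<in>{..k}. \<zero>)"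
    using assms by (auto intro!: R.finsum_cong' simp del: R.finsum_zero)
  then show ?thesis using False by simp
qed

lemma monom_ring_centre:
  assumes "z \<in> ring_centre R"
  shows "monom P z n \<in> ring_centre P"
proof -
  have z: "z \<in> carrier R"
    using assms by (rule ring_centre_closed)
  have "monom P z n \<otimes>\<^bsub>P\<^esub> q = q \<otimes>\<^bsub>P\<^esub> monom P z n" if "q \<in> carrier P" for q
    using that z ring_centre_commute[OF assms]
    by (intro up_eqI) (simp_all add: coeff_monom_mult coeff_mult_monom del: coeff_mult)
  then show ?thesis using z by (simp add: ring_centre_def)
qed

text \<open>A central polynomial commutes with every constant polynomial; compare
  coefficients.\<close>

lemma coeff_ring_centre:
  assumes "c \<in> ring_centre P"
  shows "coeff P c n \<in> ring_centre R"
proof -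
  have c: "c \<in> carrier P"
    using assms by (rule ring_centre_closed)
  have "coeff P c n \<otimes> x = x \<otimes> coeff P c n" if x: "x \<in> carrier R" for x
    using arg_cong[OF ring_centre_commute[OF assms monom_closed[OF x, of 0]], of "\<lambda>p. coeff P p n"]
      x c by (simp add: coeff_monom_mult coeff_mult_monom del: coeff_mult)
  then show ?thesis using c by (simp add: ring_centre_def)
qed

lemma monom_pow: "a \<in> carrier R \<Longrightarrow> monom P a n [^]\<^bsub>P\<^esub> (k::nat) = monom P (a [^] k) (n * k)"
  by (induction k) (simp_all add: add.commute[of n] flip: monom_mult)

lemma monom_nilpotents: "a \<in> nilpotents R \<Longrightarrow> monom P a n \<in> nilpotents P"
  by (auto simp: nilpotents_def monom_pow, metis monom_zero)

text \<open>Taking the constant term is multiplicative, so it maps inverses to inverses.\<close>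

lemma coeff_0_Units:
  assumes "w \<in> Units P"
  shows "coeff P w 0 \<in> Units R"
proof -
  obtain q where w: "w \<in> carrier P" and q: "q \<in> carrier P" "w \<otimes>\<^bsub>P\<^esub> q = \<one>\<^bsub>P\<^esub>" "q \<otimes>\<^bsub>P\<^esub> w = \<one>\<^bsub>P\<^esub>"
    using assms by (auto simp: Units_def)
  have "coeff P w 0 \<otimes> coeff P q 0 = \<one>" "coeff P q 0 \<otimes> coeff P w 0 = \<one>"
    using arg_cong[OF q(2), of "\<lambda>p. coeff P p 0"] arg_cong[OF q(3), of "\<lambda>p. coeff P p 0"] w q(1)
    by simp_all
  then show ?thesis
    using w q(1) unfolding Units_def by (blast intro: coeff_closed)
qed

lemma monom_0_Units:
  assumes "u \<in> Units R"
  shows "monom P u 0 \<in> Units P"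
proof -
  have "monom P u 0 \<otimes>\<^bsub>P\<^esub> monom P (inv u) 0 = \<one>\<^bsub>P\<^esub>" "monom P (inv u) 0 \<otimes>\<^bsub>P\<^esub> monom P u 0 = \<one>\<^bsub>P\<^esub>"
    using monom_mult[of u "inv u" 0 0] monom_mult[of "inv u" u 0 0] assms
    by (simp_all add: R.Units_closed)
  then show ?thesis
    using R.Units_closed[OF assms] R.Units_inv_closed[OF assms] unfolding Units_def
    by (blast intro: monom_closed)
qed

text \<open>The inverse of \<open>1 - b x\<close> can only be the geometric series, which must terminate.\<close>

lemma nilpotents_if_one_minus_monom_Units:
  assumes b: "b \<in> carrier R" and "\<one>\<^bsub>P\<^esub> \<ominus>\<^bsub>P\<^esub> monom P b 1 \<in> Units P"
  shows "b \<in> nilpotents R"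
proof -
  obtain q where q: "q \<in> carrier P" "(\<one>\<^bsub>P\<^esub> \<ominus>\<^bsub>P\<^esub> monom P b 1) \<otimes>\<^bsub>P\<^esub> q = \<one>\<^bsub>P\<^esub>"
    using P.Units_r_inv_ex[OF assms(2)] by blast
  have "(\<one>\<^bsub>P\<^esub> \<ominus>\<^bsub>P\<^esub> monom P b 1) \<otimes>\<^bsub>P\<^esub> q = q \<ominus>\<^bsub>P\<^esub> monom P b 1 \<otimes>\<^bsub>P\<^esub> q"
    using b q(1) by (simp add: P.minus_eq P.l_distr P.l_minus)
  then have eq: "coeff P q n \<ominus> coeff P (monom P b 1 \<otimes>\<^bsub>P\<^esub> q) n = coeff P \<one>\<^bsub>P\<^esub> n" for n
    using b q coeff_minus[of q "monom P b 1 \<otimes>\<^bsub>P\<^esub> q" n] by simp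
  have "coeff P q n = b [^] n" for n
  proof (induction n)
    case 0
    then show ?case using eq[of 0] b q(1) by (simp add: coeff_monom_mult R.minus_eq del: coeff_mult)
  next
    case (Suc n)
    have "coeff P q (Suc n) = b \<otimes> coeff P q n"
      using eq[of "Suc n"] b q(1) by (simp add: coeff_monom_mult del: coeff_mult)
    then show ?case using Suc R.nat_pow_Suc2[OF b] by simp
  qed
  then have "b [^] Suc (deg R q) = \<zero>"
    using deg_aboveD[of q "Suc (deg R q)"] q(1) by simp
  then show ?thesis using b unfolding nilpotents_def by blast
qed

text \<open>If \<open>q\<close> is the inverse of \<open>w\<close>, growing powers of the top
  coefficient \<open>z\<close> annihilate the coefficients of \<open>q\<close> from the top down.
  Once \<open>q\<close>'s constant term is annihilated, that power of \<open>z\<close> is zero,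
  since this term is invertible from the right.\<close>

lemma Units_top_coeff_nilpotent:
  assumes w: "w \<in> Units P" and d: "0 < d" "\<And>i. d < i \<Longrightarrow> coeff P w i = \<zero>"
    and central: "coeff P w d \<in> ring_centre R"
  shows "coeff P w d \<in> nilpotents R"
proof -
  define z where "z = coeff P w d"
  have wP: "w \<in> carrier P" and z: "z \<in> carrier R"
    using w by (auto simp: z_def)
  obtain q where q: "q \<in> carrier P" "w \<otimes>\<^bsub>P\<^esub> q = \<one>\<^bsub>P\<^esub>" "q \<otimes>\<^bsub>P\<^esub> w = \<one>\<^bsub>P\<^esub>"
    using w by (auto simp: Units_def)
  have zpow: "z [^] j \<otimes> x = x \<otimes> z [^] j" if "x \<in> carrier R" for x and j :: nat
    using R.group_commutes_pow[of z x j] ring_centre_commute[OF central] that z by (simp add: z_def)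
  have vanish: "z [^] j \<otimes> coeff P q k = \<zero>" if "deg R q < k + j" for j k :: nat
    using that
  proof (induction j arbitrary: k)
    case 0
    then show ?case using deg_aboveD q(1) by simp
  next
    case (Suc j)
    \<comment> \<open>This is \<open>z [^] j\<close> times the coefficient of \<open>w q\<close> in
      degree \<open>d + k\<close>. For \<open>i < d\<close> the index \<open>d + k - i\<close>
      exceeds \<open>k\<close>, so the induction hypothesis applies once the central
      \<open>z [^] j\<close> is moved past \<open>coeff P w i\<close>; for \<open>i > d\<close> the
      coefficient of \<open>w\<close> is zero.\<close>
    have "(\<Oplus>i\<in>{..d + k}. z [^] j \<otimes> (coeff P w i \<otimes> coeff P q (d + k - i))) =
        (\<Oplus>i\<in>{..d + k}. if d = i then z [^] Suc j \<otimes> coeff P q k else \<zero>)"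
    proof (rule R.finsum_cong')
      fix i assume "i \<in> {..d + k}"
      consider "i < d" | "i = d" | "d < i" by linarith
      then show "z [^] j \<otimes> (coeff P w i \<otimes> coeff P q (d + k - i)) =
          (if d = i then z [^] Suc j \<otimes> coeff P q k else \<zero>)"
      proof cases
        case 1
        then have "z [^] j \<otimes> coeff P q (d + k - i) = \<zero>"
          using Suc.prems by (intro Suc.IH) linarith
        then have "coeff P w i \<otimes> (z [^] j \<otimes> coeff P q (d + k - i)) = \<zero>"
          using wP by simp
        then show ?thesis
          using 1 wP q(1) z zpow[of "coeff P w i" j] by (simp flip: R.m_assoc)
      next
        case 2
        then show ?thesis using wP q(1) z by (simp add: z_def R.m_assoc)
      next
        case 3
        then show ?thesis using d(2) q(1) z by simp
      qed
    qed (use z q(1) in auto)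
    moreover have "(\<Oplus>i\<in>{..d + k}. z [^] j \<otimes> (coeff P w i \<otimes> coeff P q (d + k - i))) =
        z [^] j \<otimes> coeff P (w \<otimes>\<^bsub>P\<^esub> q) (d + k)"
      using wP q(1) z by (simp add: R.finsum_rdistr)
    moreover have "(\<Oplus>i\<in>{..d + k}. if d = i then z [^] Suc j \<otimes> coeff P q k else \<zero>) =
        z [^] Suc j \<otimes> coeff P q k"
      using R.finsum_singleton[of d "{..d + k}" "\<lambda>_. z [^] Suc j \<otimes> coeff P q k"] z q(1) by simp
    \<comment> \<open>As \<open>d\<close> is positive, \<open>\<one>\<close> has coefficient zero in
      degree \<open>d + k\<close>.\<close>
    ultimately show ?case using d(1) q(2) z by simp
  qed
  let ?n = "Suc (deg R q)"
  \<comment> \<open>Here the other product \<open>q w = \<one>\<close> serves, because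
    \<open>z [^] ?n\<close> stands to the left of \<open>coeff P q 0\<close>.\<close>
  have "coeff P (q \<otimes>\<^bsub>P\<^esub> w) 0 = \<one>" using q(3) by (simp del: coeff_mult)
  then have "coeff P q 0 \<otimes> coeff P w 0 = \<one>" using q(1) wP by simp
  then have "z [^] ?n = (z [^] ?n \<otimes> coeff P q 0) \<otimes> coeff P w 0"
    using z q(1) wP by (simp add: R.m_assoc)
  also have "\<dots> = \<zero>"
    using vanish[of 0 ?n] wP by simp
  finally show ?thesis
    using z unfolding nilpotents_def z_def by blast
qed

text \<open>A top term of degree at least 2 is removed by adding its negative, which is central and
  nilpotent and so lies in \<open>Delta P\<close>; \<open>Delta_add\<close> keeps the sum
  there.\<close>

lemma Delta_truncate:
  assumes "p \<in> Delta P" "\<And>i. 2 \<le> i \<Longrightarrow> coeff P p i \<in> ring_centre R"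
  shows "monom P (coeff P p 1) 1 \<oplus>\<^bsub>P\<^esub> monom P (coeff P p 0) 0 \<in> Delta P"
proof -
  have "monom P (coeff P p 1) 1 \<oplus>\<^bsub>P\<^esub> monom P (coeff P p 0) 0 \<in> Delta P"
    if "p \<in> Delta P" "\<And>i. 2 \<le> i \<Longrightarrow> coeff P p i \<in> ring_centre R"
      "\<And>i. n + 1 < i \<Longrightarrow> coeff P p i = \<zero>" for n p
    using that
  proof (induction n arbitrary: p)
    case 0
    have p: "p \<in> carrier P" using 0 by (simp add: Delta_closed)
    have "p = monom P (coeff P p 1) 1 \<oplus>\<^bsub>P\<^esub> monom P (coeff P p 0) 0"
    proof (rule up_eqI)
      fix i :: nat
      consider "i = 0" | "i = 1" | "1 < i" by linarith
      then show "coeff P p i = coeff P (monom P (coeff P p 1) 1 \<oplus>\<^bsub>P\<^esub> monom P (coeff P p 0) 0) i"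
        using p 0(3)[of i] by cases simp_all
    qed (use p in simp_all)
    then show ?case using 0(1) by simp
  next
    case (Suc n)
    let ?d = "n + 2"
    \<comment> \<open>With this sign \<open>z\<close> is both the top coefficient of the unit
      \<open>\<one> \<ominus> p\<close> and the coefficient that cancels the top term of
      \<open>p\<close>.\<close>
    define z where "z = \<ominus> coeff P p ?d"
    have p: "p \<in> carrier P" using Suc.prems by (simp add: Delta_closed)
    have z: "z \<in> ring_centre R" "z \<in> carrier R"
      using Suc.prems(2) p by (simp_all add: z_def R.ring_centre_a_inv)
    let ?w = "\<one>\<^bsub>P\<^esub> \<ominus>\<^bsub>P\<^esub> p"
    have "?w \<in> Units P"
      using DeltaD[OF Suc.prems(1) P.Units_one_closed] p by simp
    moreover have "coeff P ?w ?d = z"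
      using p by (simp add: coeff_minus z_def R.minus_eq)
    moreover have "coeff P ?w i = \<zero>" if "?d < i" for i
      using that p Suc.prems(3)[of i] by (simp add: coeff_minus R.minus_eq)
    ultimately have "z \<in> nilpotents R"
      using Units_top_coeff_nilpotent[of ?w ?d] z(1) by simp
    then have "monom P z ?d \<in> Delta P"
      by (intro P.central_nilpotent_Delta monom_ring_centre monom_nilpotents z(1))
    then have "p \<oplus>\<^bsub>P\<^esub> monom P z ?d \<in> Delta P" (is "?p' \<in> _")
      by (intro P.Delta_add Suc.prems(1))
    moreover have coeff': "coeff P ?p' i = (if i = ?d then \<zero> else coeff P p i)" for i
      using p z(2) by (auto simp: z_def R.r_neg)
    moreover have "coeff P ?p' i = \<zero>" if "n + 1 < i" for i
      using that Suc.prems(3)[of i] coeff'[of i] by (cases "i = ?d") auto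
    ultimately show ?case
      using Suc.IH[of ?p'] Suc.prems(2) by (simp add: R.ring_centre_zero del: coeff_add)
  qed
  moreover have "coeff P p i = \<zero>" if "deg R p + 1 < i" for i
    using that assms(1) by (intro deg_aboveD) (simp_all add: Delta_closed)
  ultimately show ?thesis using assms by blast
qed

end

text \<open>An auxiliary description of the nilpotents on which closure under addition is inherited
  from \<open>Delta\<close>. The central constant \<open>c\<close> is left free because truncation
  leaves a constant term known only to be central.\<close>

definition Delta_slopes :: "('a, 'b) ring_scheme \<Rightarrow> 'a set" where
  "Delta_slopes R = {b \<in> carrier R. \<exists>c \<in> ring_centre R.
     monom (UP R) b 1 \<oplus>\<^bsub>UP R\<^esub> monom (UP R) c 0 \<in> Delta (UP R)}"

section \<open>Slopes of the linear elements of \<open>Delta P\<close>\<close>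

context UP_ring
begin

lemma Delta_slopes_iff:
  "b \<in> Delta_slopes R \<longleftrightarrow>
     b \<in> carrier R \<and> (\<exists>c \<in> ring_centre R. monom P b 1 \<oplus>\<^bsub>P\<^esub> monom P c 0 \<in> Delta P)"
  by (simp add: Delta_slopes_def P_def)

lemma Delta_slopes_add:
  assumes "a \<in> Delta_slopes R" "b \<in> Delta_slopes R"
  shows "a \<oplus> b \<in> Delta_slopes R"
proof -
  obtain c d where a: "a \<in> carrier R" "c \<in> ring_centre R" "monom P a 1 \<oplus>\<^bsub>P\<^esub> monom P c 0 \<in> Delta P"
    and b: "b \<in> carrier R" "d \<in> ring_centre R" "monom P b 1 \<oplus>\<^bsub>P\<^esub> monom P d 0 \<in> Delta P"
    using assms unfolding Delta_slopes_iff by blast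
  have "(monom P a 1 \<oplus>\<^bsub>P\<^esub> monom P c 0) \<oplus>\<^bsub>P\<^esub> (monom P b 1 \<oplus>\<^bsub>P\<^esub> monom P d 0) =
      monom P (a \<oplus> b) 1 \<oplus>\<^bsub>P\<^esub> monom P (c \<oplus> d) 0"
    using a(1,2) b(1,2) by (simp add: P.a_ac ring_centre_closed)
  then show ?thesis
    using P.Delta_add[OF a(3) b(3)] R.ring_centre_add a(1,2) b(1,2)
    unfolding Delta_slopes_iff by auto
qed

lemma central_nilpotent_Delta_slopes:
  assumes "z \<in> ring_centre R" "z \<in> nilpotents R"
  shows "z \<in> Delta_slopes R"
  using P.central_nilpotent_Delta[OF monom_ring_centre monom_nilpotents, OF assms, of 1]
    assms R.ring_centre_zero by (auto simp: Delta_slopes_iff ring_centre_closed intro!: bexI[of _ \<zero>])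

lemma Units_mult_Delta_slopes_nilpotent:
  assumes t: "t \<in> Units R" and "b \<in> Delta_slopes R"
  shows "t \<otimes> b \<in> nilpotents R"
proof -
  obtain c where b: "b \<in> carrier R" and c: "c \<in> ring_centre R" "c \<in> carrier R"
    and r: "monom P b 1 \<oplus>\<^bsub>P\<^esub> monom P c 0 \<in> Delta P" (is "?r \<in> _")
    using assms(2) unfolding Delta_slopes_iff by (auto dest: ring_centre_closed)
  have tR: "t \<in> carrier R" using t by (rule R.Units_closed)
  have rP: "?r \<in> carrier P" using b c by simp
  \<comment> \<open>Testing \<open>?r\<close> against the unit \<open>\<ominus> t\<close> shows,
    through the constant term, that \<open>\<one> \<oplus> t \<otimes> c\<close> is a unit.\<close>
  have s: "\<ominus> t \<in> Units R"
    using R.Units_m_closed[OF R.Units_minus_one_closed t] tR by (simp add: R.l_minus)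
  have "coeff P (\<one>\<^bsub>P\<^esub> \<ominus>\<^bsub>P\<^esub> monom P (\<ominus> t) 0 \<otimes>\<^bsub>P\<^esub> ?r) 0 \<in> Units R"
    by (intro coeff_0_Units DeltaD[OF r] monom_0_Units s)
  then have "\<one> \<oplus> t \<otimes> c \<in> Units R"
    using b c(2) tR by (simp add: coeff_minus R.minus_eq R.l_minus)
  \<comment> \<open>This is \<open>inv t \<oplus> c\<close>, written as a product of units. In
    \<open>?v \<ominus> ?r\<close> the constant \<open>c\<close> then cancels.\<close>
  define v where "v = inv t \<otimes> (\<one> \<oplus> t \<otimes> c)"
  have v: "v \<in> Units R"
    using \<open>\<one> \<oplus> t \<otimes> c \<in> Units R\<close> t by (simp add: v_def)
  have tv: "t \<otimes> v = \<one> \<oplus> t \<otimes> c"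
    using t tR c(2) by (simp add: v_def flip: R.m_assoc)
  let ?t = "monom P t 0" and ?v = "monom P v 0" and ?v' = "monom P (inv v) 0"
  have vv': "?v \<otimes>\<^bsub>P\<^esub> ?v' = \<one>\<^bsub>P\<^esub>"
    using monom_mult[of v "inv v" 0 0] v by (simp add: R.Units_closed)
  have vR: "v \<in> carrier R" using v by (rule R.Units_closed)
  have "?t \<otimes>\<^bsub>P\<^esub> (?v \<otimes>\<^bsub>P\<^esub> (\<one>\<^bsub>P\<^esub> \<ominus>\<^bsub>P\<^esub> ?v' \<otimes>\<^bsub>P\<^esub> ?r)) \<in> Units P"
    by (intro P.Units_m_closed monom_0_Units t v DeltaD[OF r] R.Units_inv_Units)
  moreover have "?v \<otimes>\<^bsub>P\<^esub> (\<one>\<^bsub>P\<^esub> \<ominus>\<^bsub>P\<^esub> ?v' \<otimes>\<^bsub>P\<^esub> ?r) = ?v \<ominus>\<^bsub>P\<^esub> (?v \<otimes>\<^bsub>P\<^esub> ?v') \<otimes>\<^bsub>P\<^esub> ?r"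
    using vR v rP by (simp add: P.minus_eq P.r_distr P.r_minus P.m_assoc)
  moreover have "?t \<otimes>\<^bsub>P\<^esub> (?v \<ominus>\<^bsub>P\<^esub> ?r) = \<one>\<^bsub>P\<^esub> \<ominus>\<^bsub>P\<^esub> monom P (t \<otimes> b) 1"
  proof -
    have tc: "monom P (t \<otimes> c) 0 = ?t \<otimes>\<^bsub>P\<^esub> monom P c 0"
      using monom_mult[of t c 0 0] tR c(2) by simp
    have tb: "monom P (t \<otimes> b) 1 = ?t \<otimes>\<^bsub>P\<^esub> monom P b 1"
      using monom_mult[of t b 0 1] tR b by simp
    have "?t \<otimes>\<^bsub>P\<^esub> ?v = \<one>\<^bsub>P\<^esub> \<oplus>\<^bsub>P\<^esub> monom P (t \<otimes> c) 0"
      using monom_mult[of t v 0 0] tv tR c(2) vR by simp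
    then show ?thesis
      using tR vR b c(2) rP tb tc
      by (simp add: P.minus_eq P.r_distr P.r_minus P.minus_add P.a_ac P.r_neg2 P.r_neg)
  qed
  ultimately have "\<one>\<^bsub>P\<^esub> \<ominus>\<^bsub>P\<^esub> monom P (t \<otimes> b) 1 \<in> Units P"
    using vv' rP by simp
  then show ?thesis
    using nilpotents_if_one_minus_monom_Units[of "t \<otimes> b"] tR b by simp
qed

lemma Delta_slopes_nilpotent:
  assumes "b \<in> Delta_slopes R"
  shows "b \<in> nilpotents R"
  using Units_mult_Delta_slopes_nilpotent[OF R.Units_one_closed assms] assms
  by (simp add: Delta_slopes_iff)

section \<open>Consequences of the decomposition in \<open>P\<close>\<close>

lemma CDelta_decomposition:
  assumes "CDelta_ring P" and a: "a \<in> carrier R"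
  obtains c b where "c \<in> ring_centre R" "b \<in> Delta_slopes R" "a = c \<oplus> b"
proof -
  obtain c r where c: "c \<in> ring_centre P" and r: "r \<in> Delta P" and eq: "monom P a 1 = c \<oplus>\<^bsub>P\<^esub> r"
    using assms unfolding CDelta_ring_def by (meson monom_closed)
  have cP: "c \<in> carrier P" and rP: "r \<in> carrier P"
    using c r by (simp_all add: ring_centre_closed Delta_closed)
  have sum: "coeff P c i \<oplus> coeff P r i = (if i = 1 then a else \<zero>)" for i
    using arg_cong[OF eq, of "\<lambda>p. coeff P p i"] a cP rP by (simp split: if_splits)
  \<comment> \<open>Away from degree 1 the coefficients of \<open>c\<close> and \<open>r\<close>
    cancel, and those of the central \<open>c\<close> are central.\<close>
  have central: "coeff P r i \<in> ring_centre R" if "i \<noteq> 1" for i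
  proof -
    have "coeff P r i = \<ominus> coeff P c i"
      using sum[of i] that cP rP R.minus_equality R.a_comm by (metis coeff_closed)
    then show ?thesis
      using R.ring_centre_a_inv[OF coeff_ring_centre[OF c]] by simp
  qed
  have "monom P (coeff P r 1) 1 \<oplus>\<^bsub>P\<^esub> monom P (coeff P r 0) 0 \<in> Delta P"
    by (intro Delta_truncate r central) simp
  then have "coeff P r 1 \<in> Delta_slopes R"
    unfolding Delta_slopes_iff using rP central[of 0] by auto
  moreover have "a = coeff P c 1 \<oplus> coeff P r 1"
    using sum[of 1] by simp
  ultimately show thesis
    using that coeff_ring_centre[OF c] by blast
qed

text \<open>Write a nilpotent \<open>n\<close> as \<open>c \<oplus> b\<close> with \<open>c\<close>
  central and \<open>b\<close> a slope. Then \<open>b\<close> is nilpotent and commutes with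
  \<open>n\<close>, so \<open>c = n \<ominus> b\<close> is a central nilpotent and hence a slope
  too.\<close>

lemma nilpotents_eq_Delta_slopes:
  assumes "CDelta_ring P"
  shows "nilpotents R = Delta_slopes R"
proof (intro equalityI subsetI)
  fix n assume n: "n \<in> nilpotents R"
  obtain c b where c: "c \<in> ring_centre R" and b: "b \<in> Delta_slopes R" and eq: "n = c \<oplus> b"
    using CDelta_decomposition[OF assms nilpotents_closed[OF n]] .
  have cR: "c \<in> carrier R" and bR: "b \<in> carrier R"
    using c b by (simp_all add: ring_centre_closed Delta_slopes_iff)
  have "n \<otimes> \<ominus> b = \<ominus> b \<otimes> n"
    using cR bR ring_centre_commute[OF c bR] by (simp add: eq R.l_distr R.r_distr R.l_minus R.r_minus R.minus_add)
  then have "n \<oplus> \<ominus> b \<in> nilpotents R"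
    by (intro R.nilpotents_add_commuting n R.nilpotents_a_inv Delta_slopes_nilpotent[OF b])
  moreover have "n \<oplus> \<ominus> b = c"
    using cR bR by (simp add: eq R.a_assoc R.r_neg)
  ultimately have "c \<in> Delta_slopes R"
    using c by (simp add: central_nilpotent_Delta_slopes)
  then show "n \<in> Delta_slopes R"
    using b by (simp add: eq Delta_slopes_add)
qed (rule Delta_slopes_nilpotent)

lemma nilpotents_ideal:
  assumes "CDelta_ring P"
  shows "ideal (nilpotents R) R"
proof -
  have add: "a \<oplus> b \<in> nilpotents R" if "a \<in> nilpotents R" "b \<in> nilpotents R" for a b
    using that by (simp add: nilpotents_eq_Delta_slopes[OF assms] Delta_slopes_add)
  have mult: "a \<otimes> b \<in> nilpotents R" if ab: "a \<in> nilpotents R" "b \<in> nilpotents R" for a b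
  proof -
    \<comment> \<open>A unit times a slope is nilpotent, so making \<open>\<one> \<oplus> a\<close>
      a unit gives access to the product \<open>a \<otimes> b\<close>.\<close>
    have "\<one> \<oplus> a \<in> Units R"
      using R.one_minus_nilpotent_Units[OF R.nilpotents_a_inv[OF ab(1)]] nilpotents_closed[OF ab(1)]
      by (simp add: R.minus_eq)
    then have "(\<one> \<oplus> a) \<otimes> b \<in> nilpotents R"
      using ab(2) Units_mult_Delta_slopes_nilpotent by (simp add: nilpotents_eq_Delta_slopes[OF assms])
    then have "(\<one> \<oplus> a) \<otimes> b \<oplus> \<ominus> b \<in> nilpotents R"
      by (intro add R.nilpotents_a_inv ab(2))
    moreover have "(\<one> \<oplus> a) \<otimes> b \<oplus> \<ominus> b = a \<otimes> b"
      using ab[THEN nilpotents_closed] R.r_neg1[of b "a \<otimes> b"] by (simp add: R.l_distr R.a_ac)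
    ultimately show ?thesis by simp
  qed
  have "x \<otimes> a \<in> nilpotents R \<and> a \<otimes> x \<in> nilpotents R"
    if a: "a \<in> nilpotents R" and x: "x \<in> carrier R" for a x
  proof -
    \<comment> \<open>The central part of \<open>x\<close> multiplies \<open>a\<close> to a
      nilpotent because they commute; for the part \<open>b\<close>, both products with
      \<open>a\<close> are covered by \<open>mult\<close>.\<close>
    obtain c b where c: "c \<in> ring_centre R" and "b \<in> Delta_slopes R" and eq: "x = c \<oplus> b"
      using CDelta_decomposition[OF assms x] .
    then have b: "b \<in> nilpotents R" by (simp add: Delta_slopes_nilpotent)
    have R: "a \<in> carrier R" "b \<in> carrier R" "c \<in> carrier R"
      using a b c by (simp_all add: nilpotents_closed ring_centre_closed)
    have ca: "c \<otimes> a = a \<otimes> c" using c R(1) by (rule ring_centre_commute)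
    have "a \<otimes> c \<in> nilpotents R"
      using R.nilpotents_mult_commuting[OF a R(3)] ca by simp
    then show ?thesis
      using add mult a b R ca by (simp add: eq R.l_distr R.r_distr)
  qed
  moreover have "subgroup (nilpotents R) (add_monoid R)"
  proof (rule R.add.subgroupI)
    have "\<zero> [^] (1::nat) = \<zero>" by simp
    then show "nilpotents R \<noteq> {}" unfolding nilpotents_def by blast
  qed (auto simp: nilpotents_closed add R.nilpotents_a_inv)
  ultimately show ?thesis
    by (intro idealI R.ring_axioms) auto
qed

end

theorem theorem3p10:
  fixes R :: "('a, 'b) ring_scheme"
  assumes "ring R"
    and "CDelta_ring (UP R)"
  shows "satisfies_Koethe R"
proof -
  interpret UP_ring R "UP R"
    using assms(1) by (simp add: UP_ring_def)
  have ideal: "ideal (nilpotents R) R"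
    using assms(2) by (rule nilpotents_ideal)
  have "nil_subset R (nilpotents R)"
    unfolding nil_subset_def
  proof
    fix a assume "a \<in> nilpotents R"
    then obtain n :: nat where "a \<in> carrier R" "a [^]\<^bsub>R\<^esub> n = \<zero>\<^bsub>R\<^esub>"
      by (auto simp: nilpotents_def)
    \<comment> \<open>The successor supplies the positive exponent that \<open>nil_subset\<close>
      demands.\<close>
    then have "a [^]\<^bsub>R\<^esub> Suc n = \<zero>\<^bsub>R\<^esub>" by simp
    then show "\<exists>n::nat. n > 0 \<and> a [^]\<^bsub>R\<^esub> n = \<zero>\<^bsub>R\<^esub>" by blast
  qed
  then have "nilpotents R \<subseteq> upper_nilradical R"
    by (rule R.nil_ideal_subset_upper_nilradical[OF ideal])
  \<comment> \<open>Left and right ideals are handled together through their common parent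
    \<open>additive_subgroup\<close>.\<close>
  then have "I \<subseteq> upper_nilradical R" if "nil_subset R I" "additive_subgroup I R" for I
    using nil_subset_nilpotents[OF that(1)] additive_subgroup.a_subset[OF that(2)] by blast
  then show ?thesis
    unfolding satisfies_Koethe_def by (blast dest: left_ideal.axioms(1) right_ideal.axioms(1))
qed

end
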